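(* Assume that for some constants $C_0>0$ and $\alpha>0$, $\mu(B(x,r))\le C_0r^\alpha$ for all $x\in E$, $r>0$, where $B(x,r):=\{y\in E:d(y,x)<r\}$, and that the transition density function of $X$ satisfies $$p(t,y,z)\le\frac{C_1}{t^{\alpha/\beta}}\exp\left\{-C_2\left(\frac{d(y,z)}{t^{1/\beta}}\right)^{\beta/(\beta-1)}\right\},\qquad \forall\,0<t\le T,\ y,z\in E,$$ for some $\beta>1$, $T>0$, $C_1>0$ and $C_2>0$. Then for any $x\in E$ and $B\in\mathscr B^n(E)$, $$\liminf_{t\downarrow0}\frac{-t^{1/(\beta-1)}\cdot\log\mathbb P^x[\sigma_B\le t]}{C_2}\ge\widetilde d(x,B)^{\beta/(\beta-1)}.$$
   Context: $(E,d)$ is a separable metric space whose induced topology is Lusin; $\mu$ is a $\sigma$-finite Borel measure on $E$ with full support; $X=(\Omega,\mathscr F,\mathscr F_t,X_t,\theta_t,\mathbb P^x)$ is a Borel right process on $E$ with transition function $(P_t)_{t\ge0}$ satisfying (AC): $P_t(x,\cdot)$ is absolutely continuous with respect to $\mu$ for every $t>0$, $x\in E$. Under (AC) there is a nonnegative Borel function $p(t,x,y)$ on $(0,\infty)\times E\times E$, the transition density function, with $P_tf(x)=\int_E p(t,x,y)f(y)\,\mu(dy)$ for all bounded Borel $f$. Nearly Borel sets $\mathscr B^n(E)$: $B\subset E$ such that for each probability measure $\nu$ on $E$ there are Borel $B_1\subset B\subset B_2$ with $\mathbb P^\nu(X_t\in B_2\setminus B_1\text{ for some }t\ge0)=0$.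 $\sigma_B:=\inf\{t>0:X_t\in B\}$, $\inf\emptyset=\infty$. $\mathscr N:=\{N\in\mathscr B^n(E):\mathbb P^y[\sigma_N<\infty]=0\ \forall y\in E\}$ (polar sets); $d(x,B):=\inf\{d(x,y):y\in B\}$ (with $d(x,\emptyset)=\infty$); $\widetilde d(x,B):=\sup_{N\in\mathscr N}d(x,B\setminus N)\in[0,\infty]$. Convention $\log0=-\infty$. *)

theory Defs
  imports "HOL-Probability.Probability" "HOL-Probability.Stopping_Time"
begin

section \<open>State space\<close>

text \<open>A topological space is Lusin if it is homeomorphic to a Borel subset of a compact metric space.
  Every compact metric space embeds as a closed subset into the Hilbert cube
  \<open>[0,1]\<close>^\<open>\<nat>\<close>, so the compact metric space may be taken to be the Hilbert cube.\<close>

definition lusin_space :: "'a topology \<Rightarrow> bool" where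
  "lusin_space U \<longleftrightarrow>
     (\<exists>K :: (nat \<Rightarrow> real) set.
        K \<in> sets borel \<and> K \<subseteq> {h. \<forall>n. 0 \<le> h n \<and> h n \<le> 1} \<and>
        U homeomorphic_space (top_of_set K))"

definition full_support :: "'a::topological_space measure \<Rightarrow> bool" where
  "full_support \<mu> \<longleftrightarrow> (\<forall>U. open U \<and> U \<noteq> {} \<longrightarrow> emeasure \<mu> U > 0)"

section \<open>Borel right processes\<close>

text \<open>A process takes its values in \<open>'a option\<close>: \<open>Some x\<close> is the point \<open>x\<close> of the state space
  \<open>E = UNIV\<close> and \<open>None\<close> is the cemetery, so that a process with (sub-Markovian) transition function
  may have a finite lifetime; conservative processes are those that never visit \<open>None\<close>.
  Only times \<open>t \<ge> 0\<close> are relevant.\<close>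

definition sub_markov_transition_function ::
    "(real \<Rightarrow> 'a::topological_space \<Rightarrow> 'a measure) \<Rightarrow> bool" where
  "sub_markov_transition_function Pt \<longleftrightarrow>
     (\<forall>t\<ge>0. Pt t \<in> borel \<rightarrow>\<^sub>M subprob_algebra borel) \<and>
     (\<forall>x. Pt 0 x = return borel x) \<and>
     (\<forall>s\<ge>0. \<forall>t\<ge>0. \<forall>x. Pt (s + t) x = Pt s x \<bind> Pt t)"

text \<open>The raw filtration \<open>\<F>\<^sup>0\<^sub>t = \<sigma>(X\<^sub>s; s \<le> t)\<close>, \<open>t \<in> [0,\<infinity>]\<close>.\<close>

definition raw_filtration ::
    "'w set \<Rightarrow> (real \<Rightarrow> 'w \<Rightarrow> 'a::topological_space option) \<Rightarrow> ennreal \<Rightarrow> 'w measure" where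
  "raw_filtration \<Omega> X t =
     sigma \<Omega> {{\<omega> \<in> \<Omega>. X s \<omega> \<in> Some ` A} | s A. 0 \<le> s \<and> ennreal s \<le> t \<and> A \<in> sets borel}"

definition initial_law :: "'a::topological_space measure \<Rightarrow> bool" where
  "initial_law \<nu> \<longleftrightarrow> prob_space \<nu> \<and> sets \<nu> = sets borel"

text \<open>The measure with initial law \<open>\<nu>\<close>, \<open>\<P>\<^sup>\<nu> = \<integral> \<P>\<^sup>x \<nu>(dx)\<close>, is \<open>\<nu> \<bind> \<P>\<close>.  The usual augmentation is
  \<open>\<F>\<^sub>t = \<Inter>\<^sub>\<nu> \<F>\<^sup>\<nu>\<^sub>t\<close>, where \<open>\<F>\<^sup>\<nu>\<^sub>t\<close> is generated by \<open>\<F>\<^sup>0\<^sub>t\<close> and the null sets of the completion of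
  \<open>(\<F>\<^sup>0\<^sub>\<infinity>, \<P>\<^sup>\<nu>)\<close>; moreover \<open>\<F> = \<F>\<^sub>\<infinity>\<close>.\<close>

definition augmented_filtration ::
    "'w set \<Rightarrow> (real \<Rightarrow> 'w \<Rightarrow> 'a::topological_space option) \<Rightarrow> ('a \<Rightarrow> 'w measure)
      \<Rightarrow> ennreal \<Rightarrow> 'w measure" where
  "augmented_filtration \<Omega> X P t =
     sigma \<Omega> {A. A \<subseteq> \<Omega> \<and> (\<forall>\<nu>. initial_law \<nu> \<longrightarrow>
       (\<exists>A'\<in>sets (raw_filtration \<Omega> X t). sym_diff A A' \<in> null_sets (completion (\<nu> \<bind> P))))}"

text \<open>The measures \<open>\<P>\<^sup>x\<close>, \<open>x \<in> E\<close>, are given on the raw \<open>\<sigma>\<close>-algebra \<open>\<F>\<^sup>0\<^sub>\<infinity>\<close>; probabilities of events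
  in \<open>\<F>\<close> are taken in their completions.  Since \<open>None\<close> is a trap for all paths,
  no measure started from the cemetery is needed.\<close>

locale borel_right_process =
  fixes \<Omega> :: "'w set"
    and X :: "real \<Rightarrow> 'w \<Rightarrow> 'a::topological_space option"
    and \<theta> :: "real \<Rightarrow> 'w \<Rightarrow> 'w"
    and P :: "'a \<Rightarrow> 'w measure"
    and Pt :: "real \<Rightarrow> 'a \<Rightarrow> 'a measure"
  assumes kernel: "P \<in> borel \<rightarrow>\<^sub>M prob_algebra (raw_filtration \<Omega> X \<infinity>)"
    and transition_function: "sub_markov_transition_function Pt"
    and transition: "\<And>t x A. 0 \<le> t \<Longrightarrow> A \<in> sets borel \<Longrightarrow>
          emeasure (Pt t x) A = emeasure (P x) {\<omega> \<in> \<Omega>. X t \<omega> \<in> Some ` A}"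
    and normal: "\<And>x. AE \<omega> in P x. X 0 \<omega> = Some x"
    and cemetery: "\<And>s t \<omega>. \<omega> \<in> \<Omega> \<Longrightarrow> 0 \<le> s \<Longrightarrow> s \<le> t \<Longrightarrow> X s \<omega> = None \<Longrightarrow> X t \<omega> = None"
    and right_continuous: "\<And>t \<omega> y U. \<omega> \<in> \<Omega> \<Longrightarrow> 0 \<le> t \<Longrightarrow> X t \<omega> = Some y \<Longrightarrow> open U \<Longrightarrow> y \<in> U \<Longrightarrow>
          eventually (\<lambda>s. X s \<omega> \<in> Some ` U) (at_right t)"
    and shift_space: "\<And>t \<omega>. 0 \<le> t \<Longrightarrow> \<omega> \<in> \<Omega> \<Longrightarrow> \<theta> t \<omega> \<in> \<Omega>"
    and shift: "\<And>s t \<omega>. 0 \<le> s \<Longrightarrow> 0 \<le> t \<Longrightarrow> \<omega> \<in> \<Omega> \<Longrightarrow> X s (\<theta> t \<omega>) = X (s + t) \<omega>"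
    and filtration_right_continuous: "\<And>t. 0 \<le> t \<Longrightarrow>
          sets (augmented_filtration \<Omega> X P (ennreal t)) =
            (\<Inter>s\<in>{t<..}. sets (augmented_filtration \<Omega> X P (ennreal s)))"
    \<comment> \<open>\<open>\<P>\<^sup>\<nu>[X\<^bsub>T+s\<^esub> \<in> A | \<F>\<^sub>T] = P\<^sub>s(X\<^sub>T, A)\<close> on \<open>{T < \<infinity>}\<close>, where \<open>P\<^sub>s(None, A) = 0\<close>\<close>
    and strong_markov: "\<And>\<nu> T s A G. initial_law \<nu> \<Longrightarrow>
          stopping_time (augmented_filtration \<Omega> X P) T \<Longrightarrow> 0 \<le> s \<Longrightarrow> A \<in> sets borel \<Longrightarrow>
          G \<in> sets (filtration.pre_sigma \<Omega> (augmented_filtration \<Omega> X P) T) \<Longrightarrow>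
          emeasure (completion (\<nu> \<bind> P))
            {\<omega> \<in> G. T \<omega> < \<infinity> \<and> X (enn2real (T \<omega>) + s) \<omega> \<in> Some ` A} =
          (\<integral>\<^sup>+\<omega>. indicator {\<omega> \<in> G. T \<omega> < \<infinity>} \<omega> *
              (case X (enn2real (T \<omega>)) \<omega> of None \<Rightarrow> 0 | Some y \<Rightarrow> emeasure (Pt s y) A)
            \<partial>completion (\<nu> \<bind> P))"

text \<open>The density is Borel on \<open>(0,\<infinity>) \<times> E \<times> E\<close>; values at \<open>t \<le> 0\<close> are irrelevant.\<close>

definition transition_density ::
    "'a::topological_space measure \<Rightarrow> (real \<Rightarrow> 'a \<Rightarrow> 'a measure) \<Rightarrow> (real \<Rightarrow> 'a \<Rightarrow> 'a \<Rightarrow> real) \<Rightarrow> bool"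
  where
  "transition_density \<mu> Pt p \<longleftrightarrow>
     (\<forall>t>0. \<forall>x y. 0 \<le> p t x y) \<and>
     (\<lambda>(t, x, y). p t x y) \<in> borel_measurable (restrict_space borel ({0<..} \<times> UNIV)) \<and>
     (\<forall>t>0. \<forall>x. \<forall>f :: 'a \<Rightarrow> real. f \<in> borel_measurable borel \<and> bounded (range f) \<longrightarrow>
        integrable \<mu> (\<lambda>y. p t x y * f y) \<and>
        (\<integral>y. f y \<partial>Pt t x) = (\<integral>y. p t x y * f y \<partial>\<mu>))"

section \<open>Nearly Borel sets, hitting times and polar sets\<close>

definition nearly_borel ::
    "(real \<Rightarrow> 'w \<Rightarrow> 'a::topological_space option) \<Rightarrow> ('a \<Rightarrow> 'w measure) \<Rightarrow> 'a set set" where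
  "nearly_borel X P =
     {B. \<forall>\<nu>. initial_law \<nu> \<longrightarrow>
        (\<exists>B1\<in>sets borel. \<exists>B2\<in>sets borel. B1 \<subseteq> B \<and> B \<subseteq> B2 \<and>
           (AE \<omega> in \<nu> \<bind> P. \<not> (\<exists>t\<ge>0. X t \<omega> \<in> Some ` (B2 - B1))))}"

definition hitting_time :: "(real \<Rightarrow> 'w \<Rightarrow> 'a option) \<Rightarrow> 'a set \<Rightarrow> 'w \<Rightarrow> ennreal" where
  "hitting_time X B \<omega> = Inf (ennreal ` {t. 0 < t \<and> X t \<omega> \<in> Some ` B})"

text \<open>The almost-everywhere quantifier amounts to \<open>\<P>\<^sup>y[\<sigma>\<^sub>N < \<infinity>] = 0\<close> in the completion of \<open>\<P>\<^sup>y\<close>.\<close>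

definition polar_sets ::
    "(real \<Rightarrow> 'w \<Rightarrow> 'a::topological_space option) \<Rightarrow> ('a \<Rightarrow> 'w measure) \<Rightarrow> 'a set set" where
  "polar_sets X P =
     {N \<in> nearly_borel X P. \<forall>y. AE \<omega> in P y. \<not> hitting_time X N \<omega> < \<infinity>}"

text \<open>The library's \<open>infdist\<close> is not used because it is \<open>0\<close>, not \<open>\<infinity>\<close>, on the empty set.\<close>

definition set_dist :: "'a::metric_space \<Rightarrow> 'a set \<Rightarrow> ereal" where
  "set_dist x B = (INF y\<in>B. ereal (dist x y))"

definition polar_dist ::
    "(real \<Rightarrow> 'w \<Rightarrow> 'a::metric_space option) \<Rightarrow> ('a \<Rightarrow> 'w measure) \<Rightarrow> 'a \<Rightarrow> 'a set \<Rightarrow> ereal" where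
  "polar_dist X P x B = (SUP N\<in>polar_sets X P. set_dist x (B - N))"

section \<open>Extended real functions\<close>

text \<open>Used for arguments in \<open>[0,\<infinity>)\<close> and for arguments in \<open>[0,\<infinity>]\<close> with exponent \<open>c > 0\<close>, respectively.\<close>

definition ext_ln :: "real \<Rightarrow> ereal" where
  "ext_ln u = (if u = 0 then -\<infinity> else ereal (ln u))"

definition ext_powr :: "ereal \<Rightarrow> real \<Rightarrow> ereal" where
  "ext_powr r c = (if r = \<infinity> then \<infinity> else ereal (real_of_ereal r powr c))"

end

theory Submission
  imports Defs
begin

text \<open>The proof is a chaining argument that uses only the simple Markov property, so lifetimes play no role.
  Split \<open>[0, t]\<close> into a fixed number \<open>N\<close> of pieces. If the path gets further than \<open>r'\<close> from \<open>x\<close> before \<open>t\<close>, then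
  it is further than \<open>r' - \<eta>\<close> from \<open>x\<close> at one of the times \<open>i t / N\<close>, or for some \<open>k\<close> an increment over
  a dyadic interval of length \<open>t / (N 2^k)\<close> exceeds \<open>\<eta> (1 - \<rho>) \<rho>^k\<close>, where \<open>\<rho> = 2^(-1/(2\<beta>))\<close>. Integrating the bound
  on the density gives \<open>P\<^sub>s(y, {z. d(y, z) > r}) \<le> K exp (- \<theta> C\<^sub>2 (r / s^(1/\<beta>))^(\<beta>/(\<beta>-1)))\<close> for every \<open>\<theta> < 1\<close>.
  In the union bound the dyadic terms decay superexponentially in \<open>k\<close>, and for \<open>N\<close> large
  they are dominated by the first kind of event, which has the sharp constant. If \<open>{\<sigma>\<^sub>B \<le> t}\<close>
  is not measurable, its measure is \<open>0\<close> and the bound holds trivially.\<close>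

section \<open>Path events and the simple Markov property\<close>

context borel_right_process
begin

lemma space_raw_filtration: "space (raw_filtration \<Omega> X t) = \<Omega>"
  unfolding raw_filtration_def by (rule space_measure_of) auto

lemma space_augmented_filtration: "space (augmented_filtration \<Omega> X P t) = \<Omega>"
  unfolding augmented_filtration_def by (rule space_measure_of) auto

lemma sets_raw_filtration_mono:
  assumes "s \<le> t"
  shows "sets (raw_filtration \<Omega> X s) \<subseteq> sets (raw_filtration \<Omega> X t)"
proof -
  have "sigma_sets \<Omega> {{\<omega> \<in> \<Omega>. X u \<omega> \<in> Some ` A} | u A. 0 \<le> u \<and> ennreal u \<le> s \<and> A \<in> sets borel} \<subseteq>
      sigma_sets \<Omega> {{\<omega> \<in> \<Omega>. X u \<omega> \<in> Some ` A} | u A. 0 \<le> u \<and> ennreal u \<le> t \<and> A \<in> sets borel}"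
    by (rule sigma_sets_mono') (use assms order_trans in blast)
  then show ?thesis
    unfolding raw_filtration_def by (subst (1 2) sets_measure_of) auto
qed

lemma sets_augmented_filtration_mono:
  assumes "s \<le> t"
  shows "sets (augmented_filtration \<Omega> X P s) \<subseteq> sets (augmented_filtration \<Omega> X P t)"
proof -
  let ?G = "\<lambda>t. {A. A \<subseteq> \<Omega> \<and> (\<forall>\<nu>. initial_law \<nu> \<longrightarrow>
       (\<exists>A'\<in>sets (raw_filtration \<Omega> X t). sym_diff A A' \<in> null_sets (completion (\<nu> \<bind> P))))}"
  have "sigma_sets \<Omega> (?G s) \<subseteq> sigma_sets \<Omega> (?G t)"
    by (rule sigma_sets_mono') (use sets_raw_filtration_mono[OF assms] in blast)
  then show ?thesis
    unfolding augmented_filtration_def by (subst (1 2) sets_measure_of) auto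
qed

text \<open>\<open>strong_markov\<close> speaks of \<open>filtration.pre_sigma\<close>, whose lemmas
  become available here.\<close>

sublocale filtration \<Omega> "augmented_filtration \<Omega> X P"
  by standard (simp_all add: space_augmented_filtration sets_augmented_filtration_mono)

lemma raw_sets_augmented:
  "A \<in> sets (raw_filtration \<Omega> X t) \<Longrightarrow> A \<in> sets (augmented_filtration \<Omega> X P t)"
  using sets.sets_into_space[of A "raw_filtration \<Omega> X t"]
  unfolding augmented_filtration_def
  by (intro in_measure_of) (auto simp: space_raw_filtration intro!: bexI[of _ A])

lemma path_event_raw:
  "0 \<le> s \<Longrightarrow> ennreal s \<le> t \<Longrightarrow> A \<in> sets borel \<Longrightarrow>
    {\<omega> \<in> \<Omega>. X s \<omega> \<in> Some ` A} \<in> sets (raw_filtration \<Omega> X t)"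
  unfolding raw_filtration_def by (rule in_measure_of) auto

lemma prob_space_P: "prob_space (P x)"
  and sets_P: "sets (P x) = sets (raw_filtration \<Omega> X \<infinity>)"
  using measurable_space[OF kernel, of x] by (auto simp: space_prob_algebra)

lemma space_P: "space (P x) = \<Omega>"
  using sets_eq_imp_space_eq[OF sets_P] space_raw_filtration by simp

lemma path_event:
  "0 \<le> s \<Longrightarrow> A \<in> sets borel \<Longrightarrow> {\<omega> \<in> \<Omega>. X s \<omega> \<in> Some ` A} \<in> sets (P x)"
  unfolding sets_P by (rule path_event_raw) auto

lemma initial_law_return: "initial_law (return borel x)"
  unfolding initial_law_def by (simp add: prob_space_return)

text \<open>A fixed starting point is the case of a Dirac initial law; this turns
  \<open>strong_markov\<close> into a statement about \<open>P x\<close>.\<close>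

lemma bind_return_P: "return borel x \<bind> P = P x"
  using bind_return[OF measurable_prob_algebraD[OF kernel], of x] by simp

text \<open>This is \<open>strong_markov\<close> at the constant time \<open>s\<close> on the event
  that the path is in \<open>C\<close> at time \<open>s\<close>: there the integrand is
  \<open>emeasure (Pt h y) A\<close> for some \<open>y\<close> in \<open>C\<close>, hence at most
  \<open>c\<close>.\<close>

lemma markov_bound:
  assumes s: "0 \<le> s" and h: "0 \<le> h" and C: "C \<in> sets borel" and A: "A \<in> sets borel"
    and le: "\<And>y. y \<in> C \<Longrightarrow> emeasure (Pt h y) A \<le> c"
  shows "emeasure (P x) {\<omega> \<in> \<Omega>. X s \<omega> \<in> Some ` C \<and> X (s + h) \<omega> \<in> Some ` A}
    \<le> c * emeasure (P x) {\<omega> \<in> \<Omega>. X s \<omega> \<in> Some ` C}"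
proof -
  let ?F = "augmented_filtration \<Omega> X P" and ?G = "{\<omega> \<in> \<Omega>. X s \<omega> \<in> Some ` C}"
  let ?M = "completion (P x)"
  have st: "stopping_time ?F (\<lambda>_. ennreal s)"
    by (rule stopping_time_const)
  have G: "?G \<in> sets (pre_sigma (\<lambda>_. ennreal s))"
  proof (rule sets_pre_sigmaI[OF st])
    fix t
    \<comment> \<open>If \<open>ennreal s \<le> t\<close>, the set is \<open>?G\<close>, an event
      already known at time \<open>s\<close>; otherwise it is empty.\<close>
    show "{\<omega> \<in> ?G. ennreal s \<le> t} \<in> sets (?F t)"
      using raw_sets_augmented[OF path_event_raw[OF s _ C, of t]]
      by (cases "ennreal s \<le> t") auto
  qed
  have Gm: "?G \<in> sets ?M"
    using path_event[OF s C] by simp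
  have "{\<omega> \<in> \<Omega>. X s \<omega> \<in> Some ` C \<and> X (s + h) \<omega> \<in> Some ` A} =
      ?G \<inter> {\<omega> \<in> \<Omega>. X (s + h) \<omega> \<in> Some ` A}"
    by auto
  then have m: "{\<omega> \<in> \<Omega>. X s \<omega> \<in> Some ` C \<and> X (s + h) \<omega> \<in> Some ` A} \<in> sets (P x)"
    using path_event[OF s C, of x] path_event[OF _ A, of "s + h" x] s h by simp
  have "emeasure (P x) {\<omega> \<in> \<Omega>. X s \<omega> \<in> Some ` C \<and> X (s + h) \<omega> \<in> Some ` A} =
      emeasure ?M {\<omega> \<in> ?G. ennreal s < \<infinity> \<and> X (enn2real (ennreal s) + h) \<omega> \<in> Some ` A}"
    using m s by (simp add: conj_ac)
  also have "\<dots> = (\<integral>\<^sup>+\<omega>. indicator {\<omega> \<in> ?G. ennreal s < \<infinity>} \<omega> *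
        (case X (enn2real (ennreal s)) \<omega> of None \<Rightarrow> 0 | Some y \<Rightarrow> emeasure (Pt h y) A) \<partial>?M)"
    using strong_markov[OF initial_law_return st h A G, of x] by (simp only: bind_return_P)
  also have "\<dots> \<le> (\<integral>\<^sup>+\<omega>. c * indicator ?G \<omega> \<partial>?M)"
    by (rule nn_integral_mono) (use s le in \<open>auto split: split_indicator\<close>)
  also have "\<dots> = c * emeasure (P x) ?G"
    using Gm path_event[OF s C] by (simp add: nn_integral_cmult_indicator)
  finally show ?thesis .
qed

end

section \<open>Borel partitions and increments of the path\<close>

text \<open>The balls of radius \<open>\<epsilon>\<close> around a countable dense set cover the
  space, and disjointing them keeps the union. Some pieces may be empty.\<close>

lemma borel_partition_small:
  fixes \<epsilon> :: real
  assumes "0 < \<epsilon>"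
  obtains c :: "nat \<Rightarrow> 'a::{metric_space, second_countable_topology}" and C :: "nat \<Rightarrow> 'a set"
  where "\<And>i. C i \<in> sets borel" "disjoint_family C" "(\<Union>i. C i) = UNIV"
    "\<And>i y. y \<in> C i \<Longrightarrow> dist (c i) y < \<epsilon>"
proof -
  obtain D :: "'a set" where D: "countable D" "\<And>U. open U \<Longrightarrow> U \<noteq> {} \<Longrightarrow> \<exists>d\<in>D. d \<in> U"
    using countable_dense_setE by blast
  have "D \<noteq> {}"
    using D(2)[of UNIV] by auto
  define c where "c = from_nat_into D"
  define C where "C = disjointed (\<lambda>i. ball (c i) \<epsilon>)"
  have cov: "\<exists>i. y \<in> ball (c i) \<epsilon>" for y
  proof -
    obtain d where "d \<in> D" "d \<in> ball y \<epsilon>"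
      using D(2)[of "ball y \<epsilon>"] assms by auto
    then show ?thesis
      using from_nat_into_surj[OF D(1), of d] unfolding c_def by (auto simp: dist_commute)
  qed
  show thesis
  proof
    show "C i \<in> sets borel" for i
      unfolding C_def disjointed_def by auto
    show "disjoint_family C"
      unfolding C_def by (rule disjoint_family_disjointed)
    show "(\<Union>i. C i) = UNIV"
      unfolding C_def UN_disjointed_eq using cov by auto
    show "dist (c i) y < \<epsilon>" if "y \<in> C i" for i y
      using that disjointed_subset[of "\<lambda>i. ball (c i) \<epsilon>" i] unfolding C_def by auto
  qed
qed

locale metric_right_process = borel_right_process \<Omega> X \<theta> P Pt
  for \<Omega> :: "'w set"
    and X :: "real \<Rightarrow> 'w \<Rightarrow> 'a::{metric_space, second_countable_topology} option"
    and \<theta> P Pt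
begin

text \<open>Cutting the state space into small Borel pieces avoids joint measurability of the increment.\<close>

lemma increment_bound:
  assumes s: "0 \<le> s" and h: "0 \<le> h" and \<eta>: "0 < \<eta>"
    and le: "\<And>y. emeasure (Pt h y) {z. \<eta> / 2 < dist y z} \<le> c"
  obtains S where "S \<in> sets (P x)" "emeasure (P x) S \<le> c"
    "\<And>\<omega> y z. \<omega> \<in> \<Omega> \<Longrightarrow> X s \<omega> = Some y \<Longrightarrow> X (s + h) \<omega> = Some z \<Longrightarrow> \<eta> \<le> dist y z \<Longrightarrow> \<omega> \<in> S"
proof -
  obtain a :: "nat \<Rightarrow> 'a" and C where C: "\<And>i. C i \<in> sets borel" "disjoint_family C" "(\<Union>i. C i) = UNIV"
    "\<And>i y. y \<in> C i \<Longrightarrow> dist (a i) y < \<eta> / 4"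
    using borel_partition_small[of "\<eta> / 4"] \<eta> by (metis zero_less_divide_iff zero_less_numeral)
  \<comment> \<open>The centre \<open>a i\<close> replaces the random position: points of
    \<open>C i\<close> are within \<eta>/4 of it, so a displacement of at least \<eta> from
    \<open>C i\<close> ends in \<open>A i\<close>, while points of \<open>A i\<close> are still
    further than \<eta>/2 from every point of \<open>C i\<close>.\<close>
  define A where "A = (\<lambda>i. {z. 3 * \<eta> / 4 < dist (a i) z})"
  have A: "A i \<in> sets borel" for i
    unfolding A_def by (intro borel_open open_Collect_less continuous_intros)
  have dist_open: "open {z. \<eta> / 2 < dist y z}" for y :: 'a
    by (intro open_Collect_less continuous_intros)
  define G where "G = (\<lambda>i. {\<omega> \<in> \<Omega>. X s \<omega> \<in> Some ` C i})"
  define S where "S = (\<lambda>i. {\<omega> \<in> \<Omega>. X s \<omega> \<in> Some ` C i \<and> X (s + h) \<omega> \<in> Some ` A i})"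
  have G: "G i \<in> sets (P x)" for i
    unfolding G_def using path_event[OF s C(1)] by simp
  have "S i = G i \<inter> {\<omega> \<in> \<Omega>. X (s + h) \<omega> \<in> Some ` A i}" for i
    by (auto simp: S_def G_def)
  then have S: "S i \<in> sets (P x)" for i
    using G[of i] path_event[OF _ A, of "s + h" i x] s h by simp
  have SG: "emeasure (P x) (S i) \<le> c * emeasure (P x) (G i)" for i
    unfolding S_def G_def
  proof (rule markov_bound[OF s h C(1) A])
    fix y assume y: "y \<in> C i"
    have "A i \<subseteq> {z. \<eta> / 2 < dist y z}"
    proof
      fix z assume "z \<in> A i"
      then show "z \<in> {z. \<eta> / 2 < dist y z}"
        using C(4)[OF y] dist_triangle[of "a i" z y] by (simp add: A_def)
    qed
    then have "emeasure (Pt h y) (A i) \<le> emeasure (Pt h y) {z. \<eta> / 2 < dist y z}"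
    proof (rule emeasure_mono)
      have "sets (Pt h y) = sets borel"
        using transition_function h sets_kernel[of "Pt h" borel borel y]
        unfolding sub_markov_transition_function_def by auto
      then show "{z. \<eta> / 2 < dist y z} \<in> sets (Pt h y)"
        using borel_open[OF dist_open[of y]] by simp
    qed
    also have "\<dots> \<le> c" by (rule le)
    finally show "emeasure (Pt h y) (A i) \<le> c" .
  qed
  have disj: "disjoint_family G"
    using C(2) unfolding disjoint_family_on_def G_def by fastforce
  have "emeasure (P x) (\<Union>i. S i) \<le> (\<Sum>i. emeasure (P x) (S i))"
    by (rule emeasure_subadditive_countably) (use S in auto)
  also have "\<dots> \<le> (\<Sum>i. c * emeasure (P x) (G i))"
    by (intro suminf_le SG) auto
  \<comment> \<open>The starting events \<open>G i\<close> are disjoint, so all pieces together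
    still cost no more than \<open>c\<close>.\<close>
  also have "\<dots> = c * emeasure (P x) (\<Union>i. G i)"
    using suminf_emeasure[of G "P x"] G disj by (simp add: image_subset_iff)
  also have "\<dots> \<le> c * 1"
    by (intro mult_left_mono prob_space.measure_le_1[OF prob_space_P] zero_le)
  finally have le: "emeasure (P x) (\<Union>i. S i) \<le> c" by simp
  show thesis
  proof (rule that[OF _ le])
    show "(\<Union>i. S i) \<in> sets (P x)"
      using S by auto
    fix \<omega> y z assume *: "\<omega> \<in> \<Omega>" "X s \<omega> = Some y" "X (s + h) \<omega> = Some z" "\<eta> \<le> dist y z"
    obtain i where i: "y \<in> C i" using C(3) by auto
    have "3 * \<eta> / 4 < dist (a i) z"
      using C(4)[OF i] dist_triangle[of y z "a i"] *(4) by (simp add: dist_commute)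
    then have "\<omega> \<in> S i" using * i by (auto simp: S_def A_def)
    then show "\<omega> \<in> (\<Union>i. S i)" by auto
  qed
qed

end

section \<open>Dyadic chaining and the exit event\<close>

text \<open>Induction on the level: rounding the index \<open>j\<close> down to
  \<open>2 * (j div 2)\<close> leads to a point of the next coarser grid. This costs nothing if
  \<open>j\<close> is even and one increment of size at most \<open>e K\<close> if \<open>j\<close>
  is odd.\<close>

lemma dyadic_chaining:
  fixes f :: "real \<Rightarrow> 'a::metric_space option"
  assumes h: "0 \<le> h"
    and trap: "\<And>s t. 0 \<le> s \<Longrightarrow> s \<le> t \<Longrightarrow> f s = None \<Longrightarrow> f t = None"
    and inc: "\<And>k i y z. i < N * 2 ^ Suc k \<Longrightarrow> f (real i * (h / 2 ^ Suc k)) = Some y \<Longrightarrow>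
        f (real i * (h / 2 ^ Suc k) + h / 2 ^ Suc k) = Some z \<Longrightarrow> dist y z \<le> e k"
    and e: "\<And>k. 0 \<le> e k"
    and j: "j \<le> N * 2 ^ K" and z: "f (real j * (h / 2 ^ K)) = Some z"
  shows "\<exists>i y. i \<le> N \<and> f (real i * h) = Some y \<and> dist y z \<le> (\<Sum>k<K. e k)"
  using j z
proof (induction K arbitrary: j z)
  case 0
  then show ?case by auto
next
  case (Suc K)
  define i where "i = j div 2"
  have i: "i \<le> N * 2 ^ K"
    using Suc.prems(1) by (simp add: i_def)
  have eq: "real i * (h / 2 ^ K) = real (2 * i) * (h / 2 ^ Suc K)"
    by simp
  have "real i * (h / 2 ^ K) \<le> real j * (h / 2 ^ Suc K)"
    unfolding eq by (rule mult_right_mono) (use h in \<open>auto simp: i_def\<close>)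
  \<comment> \<open>The path is alive at the later time, so by \<open>trap\<close> it was alive at
    the earlier one.\<close>
  then obtain y where y: "f (real i * (h / 2 ^ K)) = Some y"
    using trap[of "real i * (h / 2 ^ K)" "real j * (h / 2 ^ Suc K)"] Suc.prems(2) h
    by (cases "f (real i * (h / 2 ^ K))") auto
  have yz: "dist y z \<le> e K"
  proof (cases "even j")
    case True
    then have "j = 2 * i" by (auto simp: i_def)
    then have "y = z" using y Suc.prems(2) eq by simp
    then show ?thesis using e by simp
  next
    case False
    then have ji: "j = 2 * i + 1" by (auto simp: i_def elim: oddE)
    have "real j * (h / 2 ^ Suc K) = real (2 * i) * (h / 2 ^ Suc K) + h / 2 ^ Suc K"
      unfolding ji by (simp add: field_simps)
    then show ?thesis
      using inc[of "2 * i" K y z] y Suc.prems ji eq by simp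
  qed
  obtain i' y' where "i' \<le> N" "f (real i' * h) = Some y'" "dist y' y \<le> (\<Sum>k<K. e k)"
    using Suc.IH[OF i y] by auto
  then show ?case
    using yz dist_triangle[of y' z y] by (intro exI[of _ i'] exI[of _ y']) auto
qed

context metric_right_process
begin

lemma sets_dist_gt: "{z :: 'a. r < dist y z} \<in> sets borel"
  by (intro borel_open open_Collect_less continuous_intros)

text \<open>If the path is beyond \<open>r\<close> at some time before \<open>t\<close>, right
  continuity puts it there at a dyadic time too. Chaining leads back from this time to a multiple of
  \<open>t / N\<close> with displacement at most \<eta>, unless some dyadic increment exceeds its
  \<open>e k\<close>. The set \<open>S\<close> collects the \<open>Suc N\<close> coarse events and,
  for each \<open>k\<close>, the exceptional sets of \<open>N * 2 ^ Suc k\<close>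
  increments.\<close>

lemma exit_bound:
  fixes N :: nat
  assumes t: "0 < t" and N: "1 \<le> N"
    and e: "\<And>k. 0 < e k" "\<And>K. (\<Sum>k<K. e k) \<le> \<eta>"
    and c0: "\<And>s. 0 \<le> s \<Longrightarrow> s \<le> t \<Longrightarrow> emeasure (Pt s x) {z. r - \<eta> < dist x z} \<le> c0"
    and c: "\<And>k y. emeasure (Pt (t / N / 2 ^ Suc k) y) {z. e k / 2 < dist y z} \<le> c k"
  shows "\<exists>S\<in>sets (P x).
    {\<omega> \<in> \<Omega>. \<exists>s. 0 \<le> s \<and> s < t \<and> X s \<omega> \<in> Some ` {z. r < dist x z}} \<subseteq> S \<and>
    emeasure (P x) S \<le> of_nat (Suc N) * c0 + (\<Sum>k. of_nat (N * 2 ^ Suc k) * c k)"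
proof -
  define h where "h = t / N"
  have h: "0 < h" and Nh: "real N * h = t"
    using t N by (auto simp: h_def)
  define G where "G = (\<lambda>i::nat. {\<omega> \<in> \<Omega>. X (real i * h) \<omega> \<in> Some ` {z. r - \<eta> < dist x z}})"
  have G: "G i \<in> sets (P x)" for i
    unfolding G_def using h by (intro path_event sets_dist_gt) auto
  have Gc: "emeasure (P x) (G i) \<le> c0" if "i \<le> N" for i
  proof -
    have "real i * h \<le> t"
      using that h unfolding Nh[symmetric] by (intro mult_right_mono) auto
    then have "emeasure (Pt (real i * h) x) {z. r - \<eta> < dist x z} \<le> c0"
      using c0[of "real i * h"] h by auto
    then show ?thesis
      using transition[OF _ sets_dist_gt[of "r - \<eta>" x], of "real i * h" x] h unfolding G_def by simp
  qed
  have "\<exists>S. S \<in> sets (P x) \<and> emeasure (P x) S \<le> c k \<and>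
      (\<forall>\<omega> y z. \<omega> \<in> \<Omega> \<longrightarrow> X (real i * (h / 2 ^ Suc k)) \<omega> = Some y \<longrightarrow>
        X (real i * (h / 2 ^ Suc k) + h / 2 ^ Suc k) \<omega> = Some z \<longrightarrow> e k \<le> dist y z \<longrightarrow> \<omega> \<in> S)"
    for k and i :: nat
  proof -
    have "0 \<le> real i * (h / 2 ^ Suc k)" "0 \<le> h / 2 ^ Suc k"
      using h by auto
    from increment_bound[OF this e(1)[of k] c[of k, folded h_def], of x] show ?thesis
      by metis
  qed
  then obtain S where S: "\<And>k i. S k i \<in> sets (P x)" "\<And>k i. emeasure (P x) (S k i) \<le> c k"
    "\<And>k i \<omega> y z. \<omega> \<in> \<Omega> \<Longrightarrow> X (real i * (h / 2 ^ Suc k)) \<omega> = Some y \<Longrightarrow>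
        X (real i * (h / 2 ^ Suc k) + h / 2 ^ Suc k) \<omega> = Some z \<Longrightarrow> e k \<le> dist y z \<Longrightarrow> \<omega> \<in> S k i"
    for k and i :: nat
    by metis
  define S1 where "S1 = (\<Union>i\<le>N. G i)"
  define S2 where "S2 = (\<lambda>k. \<Union>i<N * 2 ^ Suc k. S k i)"
  have m1: "S1 \<in> sets (P x)" and m2: "S2 k \<in> sets (P x)" for k
    unfolding S1_def S2_def using G S(1) by auto
  have "emeasure (P x) S1 \<le> (\<Sum>i\<le>N. emeasure (P x) (G i))"
    unfolding S1_def by (rule emeasure_subadditive_finite) (use G in auto)
  also have "\<dots> \<le> of_nat (card {..N}) * c0"
    by (rule sum_bounded_above) (use Gc in auto)
  finally have b1: "emeasure (P x) S1 \<le> of_nat (Suc N) * c0" by simp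
  have b2: "emeasure (P x) (S2 k) \<le> of_nat (N * 2 ^ Suc k) * c k" for k
  proof -
    have "emeasure (P x) (S2 k) \<le> (\<Sum>i<N * 2 ^ Suc k. emeasure (P x) (S k i))"
      unfolding S2_def by (rule emeasure_subadditive_finite) (use S(1) in auto)
    also have "\<dots> \<le> of_nat (card {..<N * 2 ^ Suc k}) * c k"
      by (rule sum_bounded_above) (use S(2) in auto)
    finally show ?thesis by simp
  qed
  have "emeasure (P x) (\<Union>k. S2 k) \<le> (\<Sum>k. emeasure (P x) (S2 k))"
    by (rule emeasure_subadditive_countably) (use m2 in auto)
  also have "\<dots> \<le> (\<Sum>k. of_nat (N * 2 ^ Suc k) * c k)"
    by (intro suminf_le b2) auto
  finally have b3: "emeasure (P x) (\<Union>k. S2 k) \<le> (\<Sum>k. of_nat (N * 2 ^ Suc k) * c k)" .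
  show ?thesis
  proof (intro bexI conjI)
    show "S1 \<union> (\<Union>k. S2 k) \<in> sets (P x)"
      using m1 m2 by auto
    have "emeasure (P x) (S1 \<union> (\<Union>k. S2 k)) \<le> emeasure (P x) S1 + emeasure (P x) (\<Union>k. S2 k)"
      by (rule emeasure_subadditive) (use m1 m2 in auto)
    also have "\<dots> \<le> of_nat (Suc N) * c0 + (\<Sum>k. of_nat (N * 2 ^ Suc k) * c k)"
      by (intro add_mono b1 b3)
    finally show "emeasure (P x) (S1 \<union> (\<Union>k. S2 k)) \<le>
        of_nat (Suc N) * c0 + (\<Sum>k. of_nat (N * 2 ^ Suc k) * c k)" .
    show "{\<omega> \<in> \<Omega>. \<exists>s. 0 \<le> s \<and> s < t \<and> X s \<omega> \<in> Some ` {z. r < dist x z}} \<subseteq> S1 \<union> (\<Union>k. S2 k)"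
    proof safe
      fix \<omega> s y
      assume \<omega>: "\<omega> \<in> \<Omega>" and s: "0 \<le> s" "s < t" and y: "X s \<omega> = Some y" "r < dist x y"
        and nin: "\<omega> \<notin> (\<Union>k. S2 k)"
      have "eventually (\<lambda>u. X u \<omega> \<in> Some ` {z. r < dist x z}) (at_right s)"
        by (rule right_continuous[OF \<omega> s(1) y(1)])
          (auto intro!: open_Collect_less continuous_intros y)
      then obtain b where b: "s < b" "\<And>u. s < u \<Longrightarrow> u < b \<Longrightarrow> X u \<omega> \<in> Some ` {z. r < dist x z}"
        unfolding eventually_at_right_field by auto
      \<comment> \<open>The room to the right of \<open>s\<close> in which the path stays beyond
        \<open>r\<close> and the time below \<open>t\<close>; the mesh \<open>g\<close> is taken
        smaller.\<close>
      define d where "d = min b t - s"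
      have d: "0 < d" using b(1) s by (auto simp: d_def)
      obtain K :: nat where K: "h / d < 2 ^ K"
        using real_arch_pow[of 2 "h / d"] by auto
      define g where "g = h / 2 ^ K"
      have g: "0 < g" "g < d"
        using h d K by (auto simp: g_def field_simps)
      \<comment> \<open>The first grid point strictly after \<open>s\<close>, even when
        \<open>s\<close> lies on the grid, since \<open>b(2)\<close> speaks of times after
        \<open>s\<close>.\<close>
      define j where "j = nat \<lfloor>s / g\<rfloor> + 1"
      have "real j = of_int \<lfloor>s / g\<rfloor> + 1"
        using s g by (simp add: j_def)
      then have "s / g < real j" "real j \<le> s / g + 1"
        by linarith+
      then have j: "s < real j * g" "real j * g \<le> s + g"
        using g by (auto simp: field_simps)
      then have j2: "real j * g < b" "real j * g < t"
        using g by (auto simp: d_def)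
      obtain z where z: "X (real j * g) \<omega> = Some z" "r < dist x z"
        using b(2)[OF j(1) j2(1)] by auto
      have "t = real (N * 2 ^ K) * g"
        using Nh by (simp add: g_def)
      then have "j \<le> N * 2 ^ K"
        using j2(2) g(1) by (metis less_imp_le mult_less_cancel_right_pos of_nat_less_iff)
      then have "\<exists>i y. i \<le> N \<and> X (real i * h) \<omega> = Some y \<and> dist y z \<le> (\<Sum>k<K. e k)"
      proof (rule dyadic_chaining[where f = "\<lambda>s. X s \<omega>", rotated 4])
        show "X (real j * (h / 2 ^ K)) \<omega> = Some z"
          using z(1) by (simp add: g_def)
        show "dist y z \<le> e k" if "i < N * 2 ^ Suc k" "X (real i * (h / 2 ^ Suc k)) \<omega> = Some y"
          "X (real i * (h / 2 ^ Suc k) + h / 2 ^ Suc k) \<omega> = Some z" for k i y z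
        proof (rule ccontr)
          assume "\<not> dist y z \<le> e k"
          then have "\<omega> \<in> S k i"
            using S(3)[OF \<omega> that(2,3)] by simp
          then show False
            using nin that(1) unfolding S2_def by blast
        qed
      qed (use h cemetery[OF \<omega>] e(1) in \<open>auto intro: less_imp_le\<close>)
      then obtain i y' where i: "i \<le> N" "X (real i * h) \<omega> = Some y'" "dist y' z \<le> \<eta>"
        using e(2)[of K] by force
      then have "r - \<eta> < dist x y'"
        using dist_triangle[of x z y'] z(2) by simp
      then show "\<omega> \<in> S1"
        using i \<omega> unfolding S1_def G_def by auto
    qed
  qed
qed

end

section \<open>Tail bounds from the volume and density bounds\<close>

text \<open>On the shell where \<open>dist y z / \<sigma>\<close> has integer part \<open>n\<close>,
  the integrand is at most \<open>exp (- c * n)\<close> because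
  \<open>n \<le> n powr \<gamma>\<close>, and the shell lies in a ball of measure at most
  \<open>C0 * ((n + 1) * \<sigma>) powr \<alpha>\<close>. The series over \<open>n\<close>
  converges, and the power of \<sigma> factors out.\<close>

lemma exp_dist_integral_bound:
  fixes \<mu> :: "'a::{metric_space, second_countable_topology} measure"
  assumes sets: "sets \<mu> = sets borel" and "0 \<le> C0" and "1 \<le> \<gamma>" and "0 < c"
    and vol: "\<And>x r. 0 < r \<Longrightarrow> emeasure \<mu> (ball x r) \<le> ennreal (C0 * r powr \<alpha>)"
  obtains K where "0 < K"
    "\<And>y \<sigma>. 0 < \<sigma> \<Longrightarrow> (\<integral>\<^sup>+z. ennreal (exp (- c * (dist y z / \<sigma>) powr \<gamma>)) \<partial>\<mu>) \<le> ennreal (K * \<sigma> powr \<alpha>)"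
proof -
  define g where "g = (\<lambda>n::nat. exp (- c * n) * (real n + 1) powr \<alpha>)"
  have "g \<in> O(\<lambda>n. 1 / real n ^ 2)"
    unfolding g_def using \<open>0 < c\<close> by real_asymp
  then have summ: "summable g"
  proof (rule summable_comparison_test_bigo[rotated])
    have "summable (\<lambda>n. norm (inverse (real n ^ 2)))"
      using inverse_power_summable[of 2, where 'a = real] by simp
    then show "summable (\<lambda>n. norm (1 / real n ^ 2))"
      by (simp only: inverse_eq_divide)
  qed
  show thesis
  proof (rule that)
    \<comment> \<open>The summand 1 keeps the constant positive when \<open>C0 = 0\<close>.\<close>
    show "0 < C0 * suminf g + 1"
      using suminf_nonneg[OF summ] \<open>0 \<le> C0\<close> by (simp add: g_def add_nonneg_pos)
    fix y :: 'a and \<sigma> :: real assume \<sigma>: "0 < \<sigma>"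
    \<comment> \<open>Whole balls stand in for the shells; the term of the shell that contains
      \<open>z\<close> already dominates.\<close>
    have pt: "ennreal (exp (- c * (dist y z / \<sigma>) powr \<gamma>)) \<le>
        (\<Sum>n. ennreal (exp (- c * real n)) * indicator (ball y ((real n + 1) * \<sigma>)) z)" for z
    proof -
      define n where "n = nat \<lfloor>dist y z / \<sigma>\<rfloor>"
      have "real n = of_int \<lfloor>dist y z / \<sigma>\<rfloor>"
        using \<sigma> by (simp add: n_def)
      then have n: "real n \<le> dist y z / \<sigma>" "dist y z / \<sigma> < real n + 1"
        by linarith+
      have "real n \<le> real n powr \<gamma>"
      proof (cases "n = 0")
        case False
        then show ?thesis using powr_mono[OF \<open>1 \<le> \<gamma>\<close>, of "real n"] by simp
      qed simp
      also have "\<dots> \<le> (dist y z / \<sigma>) powr \<gamma>"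
        using n \<open>1 \<le> \<gamma>\<close> by (intro powr_mono2) auto
      finally have "exp (- c * (dist y z / \<sigma>) powr \<gamma>) \<le> exp (- c * real n)"
        using \<open>0 < c\<close> by simp
      then have "ennreal (exp (- c * (dist y z / \<sigma>) powr \<gamma>)) \<le>
          ennreal (exp (- c * real n)) * indicator (ball y ((real n + 1) * \<sigma>)) z"
        using n(2) \<sigma> by (simp add: field_simps)
      also have "\<dots> \<le> (\<Sum>n. ennreal (exp (- c * real n)) * indicator (ball y ((real n + 1) * \<sigma>)) z)"
        (is "?F n \<le> suminf ?F")
      proof -
        have "sum ?F {n} \<le> suminf ?F"
          by (rule sum_le_suminf) auto
        then show ?thesis
          by (simp only: sum.insert sum.empty finite.emptyI empty_iff not_False_eq_True add_0_right)
      qed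
      finally show ?thesis .
    qed
    have "(\<integral>\<^sup>+z. ennreal (exp (- c * (dist y z / \<sigma>) powr \<gamma>)) \<partial>\<mu>) \<le>
        (\<integral>\<^sup>+z. (\<Sum>n. ennreal (exp (- c * real n)) * indicator (ball y ((real n + 1) * \<sigma>)) z) \<partial>\<mu>)"
      by (intro nn_integral_mono pt)
    also have "\<dots> = (\<Sum>n. ennreal (exp (- c * real n)) * emeasure \<mu> (ball y ((real n + 1) * \<sigma>)))"
      by (subst nn_integral_suminf)
        (auto simp: sets nn_integral_cmult_indicator
          intro!: borel_measurable_times_ennreal borel_measurable_indicator)
    also have "\<dots> \<le> (\<Sum>n. ennreal (C0 * \<sigma> powr \<alpha> * g n))"
    proof (intro suminf_le)
      fix n :: nat
      have "ennreal (exp (- c * real n)) * emeasure \<mu> (ball y ((real n + 1) * \<sigma>)) \<le>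
          ennreal (exp (- c * real n)) * ennreal (C0 * ((real n + 1) * \<sigma>) powr \<alpha>)"
        by (intro mult_left_mono vol) (use \<sigma> in auto)
      also have "\<dots> = ennreal (C0 * \<sigma> powr \<alpha> * g n)"
        using \<sigma> \<open>0 \<le> C0\<close> by (simp add: ennreal_mult[symmetric] g_def powr_mult mult_ac)
      finally show "ennreal (exp (- c * real n)) * emeasure \<mu> (ball y ((real n + 1) * \<sigma>)) \<le>
          ennreal (C0 * \<sigma> powr \<alpha> * g n)" .
    qed auto
    also have "\<dots> = ennreal (\<Sum>n. C0 * \<sigma> powr \<alpha> * g n)"
      by (rule suminf_ennreal2) (use \<open>0 \<le> C0\<close> summ in \<open>auto simp: g_def intro: summable_mult\<close>)
    also have "\<dots> = ennreal (C0 * suminf g * \<sigma> powr \<alpha>)"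
      using suminf_mult[OF summ, of "C0 * \<sigma> powr \<alpha>"] by (simp add: mult_ac)
    also have "\<dots> \<le> ennreal ((C0 * suminf g + 1) * \<sigma> powr \<alpha>)"
      by (intro ennreal_leI mult_right_mono) auto
    finally show "(\<integral>\<^sup>+z. ennreal (exp (- c * (dist y z / \<sigma>) powr \<gamma>)) \<partial>\<mu>) \<le>
        ennreal ((C0 * suminf g + 1) * \<sigma> powr \<alpha>)" .
  qed
qed

text \<open>The constant \<open>C2\<close> is split into shares \<theta> and 1 - \<theta>. Beyond
  distance \<open>r\<close> the factor with the first share is at most its value at \<open>r\<close>
  and leaves the integral. The second share makes the remaining integral at most of order
  \<open>s powr (\<alpha> / \<beta>)\<close>, which cancels the prefactor of the density
  bound.\<close>

lemma transition_tail_bound: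
  fixes \<mu> :: "'a::{metric_space, second_countable_topology} measure"
  assumes sets: "sets \<mu> = sets borel"
    and sub: "sub_markov_transition_function Pt"
    and dens: "transition_density \<mu> Pt p"
    and "0 \<le> C0"
    and vol: "\<And>x r. 0 < r \<Longrightarrow> emeasure \<mu> (ball x r) \<le> ennreal (C0 * r powr \<alpha>)"
    and \<beta>: "1 < \<beta>" and C1: "0 < C1" and C2: "0 < C2"
    and ub: "\<And>t y z. 0 < t \<Longrightarrow> t \<le> T \<Longrightarrow>
           p t y z \<le> C1 / t powr (\<alpha> / \<beta>) *
             exp (- C2 * (dist y z / t powr (1 / \<beta>)) powr (\<beta> / (\<beta> - 1)))"
    and \<theta>: "0 < \<theta>" "\<theta> < 1"
  obtains K where "0 < K"
    "\<And>s y r. 0 < s \<Longrightarrow> s \<le> T \<Longrightarrow> 0 \<le> r \<Longrightarrow> emeasure (Pt s y) {z. r < dist y z} \<le>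
      ennreal (K * exp (- (\<theta> * C2 * r powr (\<beta> / (\<beta> - 1)) * s powr (- (1 / (\<beta> - 1))))))"
proof -
  define \<gamma> where "\<gamma> = \<beta> / (\<beta> - 1)"
  have \<gamma>: "1 \<le> \<gamma>" using \<beta> by (simp add: \<gamma>_def field_simps)
  define c where "c = (1 - \<theta>) * C2"
  have c: "0 < c" using \<theta> C2 by (simp add: c_def)
  obtain K where K: "0 < K"
    "\<And>(y::'a) \<sigma>. 0 < \<sigma> \<Longrightarrow> (\<integral>\<^sup>+z. ennreal (exp (- c * (dist y z / \<sigma>) powr \<gamma>)) \<partial>\<mu>) \<le> ennreal (K * \<sigma> powr \<alpha>)"
    using exp_dist_integral_bound[OF sets \<open>0 \<le> C0\<close> \<gamma> c vol] by blast
  show thesis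
  proof (rule that)
    show "0 < C1 * K" using C1 K by simp
    fix s r :: real and y :: 'a assume s: "0 < s" "s \<le> T" and r: "0 \<le> r"
    define A where "A = {z. r < dist y z}"
    have A: "A \<in> sets borel"
      unfolding A_def by (intro borel_open open_Collect_less continuous_intros)
    define \<sigma> where "\<sigma> = s powr (1 / \<beta>)"
    have \<sigma>: "0 < \<sigma>" using s by (simp add: \<sigma>_def)
    define M where "M = C1 / s powr (\<alpha> / \<beta>) * exp (- (\<theta> * C2 * (r / \<sigma>) powr \<gamma>))"
    have M: "0 \<le> M" using C1 by (simp add: M_def)
    have Pts: "sets (Pt s y) = sets borel" and "subprob_space (Pt s y)"
      using sub s sets_kernel[of "Pt s" borel borel y] subprob_space_kernel[of "Pt s" borel borel y]
      unfolding sub_markov_transition_function_def by auto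
    then interpret S: subprob_space "Pt s y" by simp
    have p0: "0 \<le> p s y z" for z
      using dens s unfolding transition_density_def by auto
    have "integrable \<mu> (\<lambda>z. p s y z * indicator A z) \<and>
        (\<integral>z. indicator A z \<partial>Pt s y) = (\<integral>z. p s y z * indicator A z \<partial>\<mu>)"
    proof -
      have "bounded (range (indicator A :: 'a \<Rightarrow> real))"
        by (rule boundedI[of _ 1]) (auto simp: indicator_def)
      moreover have "(indicator A :: 'a \<Rightarrow> real) \<in> borel_measurable borel"
        using A by simp
      ultimately show ?thesis
        using dens[unfolded transition_density_def] s by metis
    qed
    then have int: "integrable \<mu> (\<lambda>z. p s y z * indicator A z)"
      and eq: "measure (Pt s y) A = (\<integral>z. p s y z * indicator A z \<partial>\<mu>)"
      using A Pts by (auto simp: sets_eq_imp_space_eq[OF Pts])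
    have "emeasure (Pt s y) A = (\<integral>\<^sup>+z. ennreal (p s y z * indicator A z) \<partial>\<mu>)"
      unfolding S.emeasure_eq_measure eq
      by (rule nn_integral_eq_integral[symmetric, OF int]) (use p0 in auto)
    also have "\<dots> \<le> (\<integral>\<^sup>+z. ennreal M * ennreal (exp (- c * (dist y z / \<sigma>) powr \<gamma>)) \<partial>\<mu>)"
    proof (rule nn_integral_mono)
      fix z
      have "p s y z * indicator A z \<le> M * exp (- c * (dist y z / \<sigma>) powr \<gamma>)"
      proof (cases "z \<in> A")
        case True
        then have "(r / \<sigma>) powr \<gamma> \<le> (dist y z / \<sigma>) powr \<gamma>"
          using r \<sigma> \<gamma> by (intro powr_mono2 divide_right_mono) (auto simp: A_def)
        then have "\<theta> * C2 * (r / \<sigma>) powr \<gamma> \<le> \<theta> * C2 * (dist y z / \<sigma>) powr \<gamma>"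
          using \<theta> C2 by simp
        then have "- C2 * (dist y z / \<sigma>) powr \<gamma> \<le>
            - (\<theta> * C2 * (r / \<sigma>) powr \<gamma>) + - c * (dist y z / \<sigma>) powr \<gamma>"
          by (simp add: c_def algebra_simps)
        then have "exp (- C2 * (dist y z / \<sigma>) powr \<gamma>) \<le>
            exp (- (\<theta> * C2 * (r / \<sigma>) powr \<gamma>)) * exp (- c * (dist y z / \<sigma>) powr \<gamma>)"
          by (simp add: exp_add[symmetric])
        then have "C1 / s powr (\<alpha> / \<beta>) * exp (- C2 * (dist y z / \<sigma>) powr \<gamma>) \<le>
            M * exp (- c * (dist y z / \<sigma>) powr \<gamma>)"
          unfolding M_def mult.assoc using C1 by (intro mult_left_mono) auto
        then show ?thesis
          using ub[OF s, of y z] True unfolding \<gamma>_def \<sigma>_def by simp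
      qed (use M in auto)
      then show "ennreal (p s y z * indicator A z) \<le>
          ennreal M * ennreal (exp (- c * (dist y z / \<sigma>) powr \<gamma>))"
        using M by (simp add: ennreal_mult[symmetric] ennreal_leI)
    qed
    also have "\<dots> = ennreal M * (\<integral>\<^sup>+z. ennreal (exp (- c * (dist y z / \<sigma>) powr \<gamma>)) \<partial>\<mu>)"
    proof (rule nn_integral_cmult)
      have "(\<lambda>z. ennreal (exp (- c * (dist y z / \<sigma>) powr \<gamma>))) \<in> borel_measurable borel"
        by measurable
      then show "(\<lambda>z. ennreal (exp (- c * (dist y z / \<sigma>) powr \<gamma>))) \<in> borel_measurable \<mu>"
        using measurable_cong_sets[OF sets refl] by blast
    qed
    also have "\<dots> \<le> ennreal M * ennreal (K * \<sigma> powr \<alpha>)"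
      by (intro mult_left_mono K(2) \<sigma>) simp
    also have "\<dots> = ennreal (C1 * K * exp (- (\<theta> * C2 * (r / \<sigma>) powr \<gamma>)))"
    proof -
      have "\<sigma> powr \<alpha> = s powr (\<alpha> / \<beta>)"
        by (simp add: \<sigma>_def powr_powr)
      then have eq: "M * (K * \<sigma> powr \<alpha>) = C1 * K * exp (- (\<theta> * C2 * (r / \<sigma>) powr \<gamma>))"
        using s by (simp add: M_def)
      have "ennreal M * ennreal (K * \<sigma> powr \<alpha>) = ennreal (M * (K * \<sigma> powr \<alpha>))"
        using M K(1) by (intro ennreal_mult[symmetric]) auto
      then show ?thesis
        by (simp only: eq)
    qed
    \<comment> \<open>The power \<beta>/(\<beta> - 1) turns the scale
      \<open>s powr (1 / \<beta>)\<close> into \<open>s powr (1 / (\<beta> - 1))\<close>.\<close>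
    also have "(r / \<sigma>) powr \<gamma> = r powr \<gamma> * s powr (- (1 / (\<beta> - 1)))"
      using \<beta> r s by (simp add: powr_divide \<sigma>_def \<gamma>_def powr_powr powr_minus_divide)
    finally show "emeasure (Pt s y) {z. r < dist y z} \<le>
      ennreal (C1 * K * exp (- (\<theta> * C2 * r powr (\<beta> / (\<beta> - 1)) * s powr (- (1 / (\<beta> - 1))))))"
      unfolding A_def \<gamma>_def by (simp add: mult.assoc)
  qed
qed

section \<open>Exit and hitting probabilities with the sharp constant\<close>

context metric_right_process
begin

text \<open>The time step \<open>t / N\<close> makes the fluctuations within one step negligible against
  the probability of being far away at one of the times \<open>i t / N\<close>, so that the constant is not lost.\<close>

lemma exit_probability_bound:
  fixes x :: 'a
  assumes \<beta>: "1 < \<beta>" and T: "0 < T" and C2: "0 < C2" and r: "0 < r" "r < r'"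
    and tail: "\<forall>\<theta>. 0 < \<theta> \<and> \<theta> < 1 \<longrightarrow> (\<exists>K>0. \<forall>s y r. 0 < s \<longrightarrow> s \<le> T \<longrightarrow> 0 \<le> r \<longrightarrow>
      emeasure (Pt s y) {z. r < dist y z} \<le>
        ennreal (K * exp (- (\<theta> * C2 * r powr (\<beta> / (\<beta> - 1)) * s powr (- (1 / (\<beta> - 1)))))))"
  shows "\<exists>K>0. \<exists>t0>0. \<forall>t. 0 < t \<longrightarrow> t \<le> t0 \<longrightarrow> (\<exists>S\<in>sets (P x).
      {\<omega> \<in> \<Omega>. \<exists>s. 0 \<le> s \<and> s < t \<and> X s \<omega> \<in> Some ` {z. r' < dist x z}} \<subseteq> S \<and>
      emeasure (P x) S \<le> ennreal (K * exp (- (C2 * r powr (\<beta> / (\<beta> - 1)) * t powr (- (1 / (\<beta> - 1)))))))"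
proof -
  define b where "b = 1 / (\<beta> - 1)"
  define \<gamma> where "\<gamma> = \<beta> / (\<beta> - 1)"
  have b: "0 < b" and \<gamma>: "0 < \<gamma>" using \<beta> by (simp_all add: b_def \<gamma>_def)
  \<comment> \<open>The midpoint splits the gap: at the coarse times the path has to be beyond
    \<open>r1\<close>, and \<eta> is left for the fluctuations in between.\<close>
  define r1 where "r1 = (r + r') / 2"
  define \<eta> where "\<eta> = r' - r1"
  have r1: "r < r1" "0 < r1" "r' - \<eta> = r1" "0 < \<eta>" using r by (auto simp: r1_def \<eta>_def)
  \<comment> \<open>The loss of \<theta> in the tail bound is paid for by \<open>r1 > r\<close>:
    this choice gives \<open>\<theta> * r1 powr \<gamma> = r powr \<gamma>\<close>, so the exponent
    of the claim appears exactly.\<close>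
  define \<theta> where "\<theta> = (r / r1) powr \<gamma>"
  have \<theta>: "0 < \<theta>" "\<theta> < 1"
    using r r1 \<gamma> powr_less_mono2[of \<gamma> "r / r1" 1] by (auto simp: \<theta>_def)
  obtain K where K: "0 < K" and tailK: "\<And>s y r. 0 < s \<Longrightarrow> s \<le> T \<Longrightarrow> 0 \<le> r \<Longrightarrow>
      emeasure (Pt s y) {z. r < dist y z} \<le> ennreal (K * exp (- (\<theta> * C2 * r powr \<gamma> * s powr (- b))))"
    using tail \<theta> unfolding b_def \<gamma>_def by auto
  define A where "A = C2 * r powr \<gamma>"
  have A: "0 < A" using C2 r by (simp add: A_def)
  have A_eq: "\<theta> * C2 * r1 powr \<gamma> = A"
    using r r1 by (simp add: \<theta>_def A_def powr_divide)
  \<comment> \<open>The bounds \<open>e k\<close> shrink by \<rho> per level, slower than the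
    spatial scale of the time steps, which shrinks by 2^(-1/\<beta>). Their ratio grows by
    2^(1/(2\<beta>)) per level, and the power \<gamma> turns this into the factor \<open>q\<close>
    below.\<close>
  define \<rho> where "\<rho> = 2 powr (- (1 / (2 * \<beta>)))"
  have \<rho>: "0 < \<rho>" "\<rho> < 1"
    using \<beta> by (auto simp: \<rho>_def powr_less_one)
  \<comment> \<open>The factor \<open>1 - \<rho>\<close> keeps the geometric sum below \<eta>; the
    power \<open>Suc k\<close> goes with steps of length t / (N 2^(k+1)).\<close>
  define e where "e = (\<lambda>k. \<eta> * (1 - \<rho>) * \<rho> ^ Suc k)"
  have e: "0 < e k" for k using \<rho> r1 by (simp add: e_def)
  have sum_e: "(\<Sum>k<K. e k) \<le> \<eta>" for K
  proof -
    have "(\<Sum>k<K. e k) = \<eta> * \<rho> * ((1 - \<rho>) * (\<Sum>k<K. \<rho> ^ k))"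
      by (simp add: e_def sum_distrib_left mult_ac)
    also have "(1 - \<rho>) * (\<Sum>k<K. \<rho> ^ k) = 1 - \<rho> ^ K"
      by (rule one_diff_power_eq[symmetric])
    also have "\<eta> * \<rho> * (1 - \<rho> ^ K) \<le> \<eta> * 1 * 1"
      using \<rho> r1 by (intro mult_mono) (auto simp: power_le_one)
    finally show ?thesis by simp
  qed
  define q where "q = 2 powr (b / 2)"
  have q: "1 < q" using b by (simp add: q_def)
  \<comment> \<open>The half is the loss in \<open>increment_bound\<close>. With
    \<open>L = t powr (- b)\<close>, the tail exponent at level \<open>m\<close> will be
    \<open>a * real N powr b * L * q ^ m\<close>.\<close>
  define a where "a = \<theta> * C2 * (\<eta> * (1 - \<rho>) / 2) powr \<gamma>"
  have a: "0 < a" using \<theta> C2 r1 \<rho> by (simp add: a_def)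
  \<comment> \<open>Large enough that \<open>A \<le> a * real N powr b\<close>, so the increments
    have at least the exponent of the coarse events.\<close>
  define N where "N = nat \<lceil>(A / a) powr (1 / b)\<rceil> + 1"
  have N: "1 \<le> N" by (simp add: N_def)
  have "(A / a) powr (1 / b) \<le> real N"
    unfolding N_def by linarith
  then have "((A / a) powr (1 / b)) powr b \<le> real N powr b"
    using b by (intro powr_mono2) auto
  then have aN: "A \<le> a * real N powr b"
    using A a b by (simp add: powr_powr field_simps)
  \<comment> \<open>Once \<open>t powr (- b)\<close> is at least \<open>M\<close>, which
    \<open>t0\<close> ensures, \<open>A * t powr (- b) * ln q\<close> is at least
    \<open>ln 4\<close>. Level \<open>m\<close> then gains a factor (1/4)^m, enough to beat its 2^m
    increments.\<close>
  define M where "M = ln 4 / (A * ln q)"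
  have M: "0 < M" using A q by (simp add: M_def)
  define t0 where "t0 = min T (M powr (- (1 / b)))"
  show ?thesis
  proof (intro exI conjI allI impI)
    \<comment> \<open>The count is \<open>N + 1\<close> for the coarse times plus \<open>N\<close>
      for the sum over all increments.\<close>
    show "0 < real (2 * N + 1) * K" "0 < t0"
      using K N T M by (auto simp: t0_def)
    fix t assume t: "0 < t" "t \<le> t0"
    have tT: "t \<le> T" using t by (simp add: t0_def)
    define L where "L = t powr (- b)"
    have L: "0 < L" using t by (simp add: L_def)
    have "(M powr (- (1 / b))) powr (- b) \<le> t powr (- b)"
      by (rule powr_mono2') (use t b in \<open>auto simp: t0_def\<close>)
    then have "M \<le> L"
      using M b by (simp add: L_def powr_powr)
    then have AL: "ln 4 \<le> A * L * ln q"
      using A q by (simp add: M_def field_simps)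
    define c0 where "c0 = ennreal (K * exp (- (A * L)))"
    define c where "c = (\<lambda>k. ennreal (K * exp (- (A * L)) * (1 / 4) ^ Suc k))"
    have c0: "emeasure (Pt s x) {z. r' - \<eta> < dist x z} \<le> c0" if s: "0 \<le> s" "s \<le> t" for s
    proof (cases "s = 0")
      case True
      \<comment> \<open>The tail bound needs a positive time. At time 0 the law is the unit mass at
        \<open>x\<close>, which gives no mass to points beyond \<open>r1 > 0\<close>.\<close>
      have "Pt 0 x = return borel x"
        using transition_function unfolding sub_markov_transition_function_def by auto
      then show ?thesis
        using True r1 by (simp add: sets_dist_gt)
    next
      case False
      then have "L \<le> s powr (- b)"
        unfolding L_def using s b by (intro powr_mono2') auto
      then have "A * L \<le> \<theta> * C2 * r1 powr \<gamma> * s powr (- b)"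
        unfolding A_eq using A by simp
      then have "ennreal (K * exp (- (\<theta> * C2 * r1 powr \<gamma> * s powr (- b)))) \<le> c0"
        unfolding c0_def using K by (intro ennreal_leI mult_left_mono) auto
      then show ?thesis
        using tailK[of s r1 x] False s tT r1 by (auto intro: order_trans)
    qed
    have c: "emeasure (Pt (t / N / 2 ^ Suc k) y) {z. e k / 2 < dist y z} \<le> c k" for k y
    proof -
      define m where "m = Suc k"
      define h where "h = t / N / 2 ^ m"
      have h: "0 < h" using t N by (simp add: h_def)
      have "h \<le> t / 1 / 1"
        unfolding h_def using t N by (intro frac_le) auto
      then have hT: "h \<le> T" using tT by simp
      have e2: "e k / 2 = \<eta> * (1 - \<rho>) / 2 * \<rho> ^ m"
        by (simp add: e_def m_def)
      have "h powr (- b) = L * real N powr b * (2 ^ m) powr b"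
        using t N by (simp add: h_def L_def powr_divide powr_minus_divide powr_mult field_simps)
      moreover have "(e k / 2) powr \<gamma> = (\<eta> * (1 - \<rho>) / 2) powr \<gamma> * (\<rho> ^ m) powr \<gamma>"
        unfolding e2 using r1 \<rho> by (intro powr_mult)
      moreover have "(\<rho> ^ m) powr \<gamma> * (2 ^ m) powr b = q ^ m"
      proof -
        have "\<gamma> = \<beta> * b"
          by (simp add: \<gamma>_def b_def)
        then have "- (1 / (2 * \<beta>)) * \<gamma> + b = b / 2"
          using \<beta> by simp
        then have "\<rho> powr \<gamma> * 2 powr b = q"
          unfolding \<rho>_def q_def powr_powr powr_add[symmetric] by (rule arg_cong)
        moreover have "(\<rho> ^ m) powr \<gamma> = (\<rho> powr \<gamma>) ^ m" "(2 ^ m) powr b = (2 powr b) ^ m"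
          using \<rho> by (simp_all add: powr_realpow[symmetric] powr_powr mult.commute)
        ultimately show ?thesis
          by (simp add: power_mult_distrib[symmetric])
      qed
      ultimately have exp_eq: "\<theta> * C2 * (e k / 2) powr \<gamma> * h powr (- b) = a * real N powr b * L * q ^ m"
        by (simp add: a_def mult_ac)
      \<comment> \<open>The linear minorant separates two gains: the 1 reproduces the exponent
        \<open>A * L\<close> of the coarse events, and the slope yields
        \<open>m * ln 4\<close>.\<close>
      have "1 + real m * ln q \<le> q ^ m"
      proof -
        have "1 + real m * ln q \<le> exp (real m * ln q)"
          by (rule exp_ge_add_one_self)
        also have "\<dots> = q ^ m"
          using q by (simp add: exp_of_nat_mult)
        finally show ?thesis .
      qed
      then have "A * L * (1 + real m * ln q) \<le> a * real N powr b * L * q ^ m"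
        using aN A L q by (intro mult_mono) auto
      moreover have "real m * ln 4 \<le> real m * (A * L * ln q)"
        using AL by (intro mult_left_mono) auto
      ultimately have "A * L + real m * ln 4 \<le> \<theta> * C2 * (e k / 2) powr \<gamma> * h powr (- b)"
        unfolding exp_eq by (simp add: algebra_simps)
      then have "exp (- (\<theta> * C2 * (e k / 2) powr \<gamma> * h powr (- b))) \<le> exp (- (A * L) + real m * ln (1 / 4))"
        by (simp add: ln_div)
      also have "\<dots> = exp (- (A * L)) * (1 / 4) ^ m"
        by (simp only: exp_add exp_of_nat_mult exp_ln zero_less_divide_1_iff zero_less_numeral)
      finally have "K * exp (- (\<theta> * C2 * (e k / 2) powr \<gamma> * h powr (- b))) \<le>
          K * (exp (- (A * L)) * (1 / 4) ^ m)"
        using K by (intro mult_left_mono) auto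
      then have "ennreal (K * exp (- (\<theta> * C2 * (e k / 2) powr \<gamma> * h powr (- b)))) \<le> c k"
        unfolding c_def m_def mult.assoc by (rule ennreal_leI)
      then show ?thesis
        using tailK[OF h hT, of "e k / 2" y] e[of k] unfolding h_def m_def by (auto intro: order_trans)
    qed
    obtain S where S: "S \<in> sets (P x)"
      "{\<omega> \<in> \<Omega>. \<exists>s. 0 \<le> s \<and> s < t \<and> X s \<omega> \<in> Some ` {z. r' < dist x z}} \<subseteq> S"
      "emeasure (P x) S \<le> of_nat (Suc N) * c0 + (\<Sum>k. of_nat (N * 2 ^ Suc k) * c k)"
      using exit_bound[OF t(1) N e sum_e c0 c] by blast
    define g where "g = (\<lambda>k. real N * K * exp (- (A * L)) * (1 / 2) ^ Suc k)"
    have "g sums (real N * K * exp (- (A * L)) * 1)"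
      unfolding g_def by (intro sums_mult power_half_series)
    then have sums: "summable g" "suminf g = real N * K * exp (- (A * L))"
      by (simp_all only: sums_iff mult_1_right)
    have gk: "of_nat (N * 2 ^ Suc k) * c k = ennreal (g k)" for k
    proof -
      have "of_nat (N * 2 ^ Suc k) * c k = ennreal (real (N * 2 ^ Suc k) * (K * exp (- (A * L)) * (1 / 4) ^ Suc k))"
        unfolding c_def ennreal_of_nat_eq_real_of_nat using K by (intro ennreal_mult[symmetric]) auto
      also have "real (N * 2 ^ Suc k) * (K * exp (- (A * L)) * (1 / 4) ^ Suc k) =
          real N * K * exp (- (A * L)) * (2 * (1 / 4)) ^ Suc k"
        unfolding power_mult_distrib by (simp add: mult_ac)
      finally show ?thesis by (simp add: g_def)
    qed
    have "0 \<le> g k" for k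
      using K by (simp add: g_def)
    then have "(\<Sum>k. of_nat (N * 2 ^ Suc k) * c k) = ennreal (real N * K * exp (- (A * L)))"
      unfolding gk sums(2)[symmetric] using sums(1) by (rule suminf_ennreal2)
    moreover have "of_nat (Suc N) * c0 = ennreal (real (Suc N) * (K * exp (- (A * L))))"
      unfolding c0_def ennreal_of_nat_eq_real_of_nat using K by (intro ennreal_mult[symmetric]) auto
    ultimately have "emeasure (P x) S \<le>
        ennreal (real (Suc N) * (K * exp (- (A * L)))) + ennreal (real N * K * exp (- (A * L)))"
      using S(3) by simp
    also have "\<dots> = ennreal (real (Suc N) * (K * exp (- (A * L))) + real N * K * exp (- (A * L)))"
      using K by (intro ennreal_plus[symmetric]) auto
    also have "\<dots> = ennreal (real (2 * N + 1) * K * exp (- (C2 * r powr (\<beta> / (\<beta> - 1)) * t powr (- (1 / (\<beta> - 1))))))"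
      unfolding A_def L_def b_def \<gamma>_def by (intro arg_cong[of _ _ ennreal]) (simp add: distrib_right)
    finally show "\<exists>S\<in>sets (P x).
      {\<omega> \<in> \<Omega>. \<exists>s. 0 \<le> s \<and> s < t \<and> X s \<omega> \<in> Some ` {z. r' < dist x z}} \<subseteq> S \<and>
      emeasure (P x) S \<le> ennreal (real (2 * N + 1) * K *
        exp (- (C2 * r powr (\<beta> / (\<beta> - 1)) * t powr (- (1 / (\<beta> - 1))))))"
      using S by auto
  qed
qed

text \<open>Almost surely the path avoids a suitable polar set \<open>N\<close> at positive times,
  so a visit to \<open>B\<close> is a visit to \<open>B - N\<close>, whose points are all further
  than \<open>r'\<close> from \<open>x\<close>. The exit bound applies up to each time
  \<open>u > t\<close>.\<close>

lemma hitting_probability_bound: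
  fixes x :: 'a
  assumes \<beta>: "1 < \<beta>" and T: "0 < T" and C2: "0 < C2" and r: "0 < r" "ereal r < polar_dist X P x B"
    and tail: "\<forall>\<theta>. 0 < \<theta> \<and> \<theta> < 1 \<longrightarrow> (\<exists>K>0. \<forall>s y r. 0 < s \<longrightarrow> s \<le> T \<longrightarrow> 0 \<le> r \<longrightarrow>
      emeasure (Pt s y) {z. r < dist y z} \<le>
        ennreal (K * exp (- (\<theta> * C2 * r powr (\<beta> / (\<beta> - 1)) * s powr (- (1 / (\<beta> - 1)))))))"
  shows "\<exists>K>0. \<exists>t0>0. \<forall>t. 0 < t \<longrightarrow> t < t0 \<longrightarrow>
      measure (completion (P x)) {\<omega> \<in> \<Omega>. hitting_time X B \<omega> \<le> ennreal t} \<le>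
        K * exp (- (C2 * r powr (\<beta> / (\<beta> - 1)) * t powr (- (1 / (\<beta> - 1)))))"
proof -
  obtain N where N: "N \<in> polar_sets X P" "ereal r < set_dist x (B - N)"
    using r(2) unfolding polar_dist_def less_SUP_iff by auto
  \<comment> \<open>\<open>exit_probability_bound\<close> gives away a little distance, so
    \<open>r'\<close> is put strictly between.\<close>
  obtain r' where r': "r < r'" "ereal r' < set_dist x (B - N)"
    using ereal_dense2[OF N(2)] by auto
  let ?g = "\<lambda>t. exp (- (C2 * r powr (\<beta> / (\<beta> - 1)) * t powr (- (1 / (\<beta> - 1)))))"
  obtain K t0 where K: "0 < K" "0 < t0" and S: "\<And>t. 0 < t \<Longrightarrow> t \<le> t0 \<Longrightarrow> \<exists>S\<in>sets (P x).
      {\<omega> \<in> \<Omega>. \<exists>s. 0 \<le> s \<and> s < t \<and> X s \<omega> \<in> Some ` {z. r' < dist x z}} \<subseteq> S \<and>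
      emeasure (P x) S \<le> ennreal (K * ?g t)"
    using exit_probability_bound[OF \<beta> T C2 r(1) r'(1) tail, of x] by blast
  show ?thesis
  proof (intro exI conjI allI impI)
    show "0 < K" "0 < t0" by fact+
    fix t assume t: "0 < t" "t < t0"
    let ?H = "{\<omega> \<in> \<Omega>. hitting_time X B \<omega> \<le> ennreal t}"
    \<comment> \<open>The infimum need not be attained: being at most \<open>t\<close>, it only
      gives a visit to \<open>B\<close> before \<open>u\<close>, for each
      \<open>u > t\<close>.\<close>
    have le: "measure (completion (P x)) ?H \<le> K * ?g u" if u: "t < u" "u < t0" for u
    proof -
      obtain S where S: "S \<in> sets (P x)" "emeasure (P x) S \<le> ennreal (K * ?g u)"
        "{\<omega> \<in> \<Omega>. \<exists>s. 0 \<le> s \<and> s < u \<and> X s \<omega> \<in> Some ` {z. r' < dist x z}} \<subseteq> S"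
        using S[of u] t u by auto
      have "AE \<omega> in completion (P x). \<not> hitting_time X N \<omega> < \<infinity>"
        using N(1) unfolding polar_sets_def AE_completion_iff by simp
      then have "AE \<omega> in completion (P x). \<omega> \<in> ?H \<longrightarrow> \<omega> \<in> S"
      proof eventually_elim
        case (elim \<omega>)
        show ?case
        proof
          assume \<omega>: "\<omega> \<in> ?H"
          then have "hitting_time X B \<omega> < ennreal u"
            using t u by (auto intro: le_less_trans simp: ennreal_lessI)
          then obtain s where s: "0 < s" "X s \<omega> \<in> Some ` B" "ennreal s < ennreal u"
            unfolding hitting_time_def Inf_less_iff by auto
          then obtain y where y: "y \<in> B" "X s \<omega> = Some y" by auto
          have "y \<notin> N"
          proof
            assume "y \<in> N"
            then have "hitting_time X N \<omega> \<le> ennreal s"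
              unfolding hitting_time_def using s(1) y(2) by (intro Inf_lower) auto
            also have "\<dots> < \<infinity>" by simp
            finally show False using elim by simp
          qed
          then have "set_dist x (B - N) \<le> ereal (dist x y)"
            unfolding set_dist_def using y(1) by (intro INF_lower) auto
          then have "r' < dist x y"
            using r'(2) by (metis less_ereal.simps(1) less_le_trans)
          moreover have "s < u"
            using s by (simp add: ennreal_less_iff)
          ultimately have "\<omega> \<in> {\<omega> \<in> \<Omega>. \<exists>s. 0 \<le> s \<and> s < u \<and> X s \<omega> \<in> Some ` {z. r' < dist x z}}"
            using \<omega> s(1) y(2) by (auto intro!: exI[of _ s])
          then show "\<omega> \<in> S"
            using S(3) by blast
        qed
      qed
      then have "emeasure (completion (P x)) ?H \<le> emeasure (completion (P x)) S"
        by (rule emeasure_mono_AE) (use S(1) in simp)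
      also have "\<dots> \<le> ennreal (K * ?g u)"
        using S(1,2) by simp
      finally show ?thesis
        unfolding measure_def using K(1) by (intro enn2real_leI) auto
    qed
    \<comment> \<open>The bound is continuous in time, so it survives the limit as \<open>u\<close>
      decreases to \<open>t\<close>.\<close>
    have "((\<lambda>u. K * ?g u) \<longlongrightarrow> K * ?g t) (at_right t)"
      using t by (intro tendsto_intros) auto
    moreover have "eventually (\<lambda>u. measure (completion (P x)) ?H \<le> K * ?g u) (at_right t)"
      unfolding eventually_at_right_field using t le by (intro exI[of _ t0]) auto
    ultimately show "measure (completion (P x)) ?H \<le> K * ?g t"
      by (rule tendsto_lowerbound) simp
  qed
qed

end

section \<open>Logarithmic asymptotics and extended real powers\<close>

text \<open>After taking logarithms the constant \<open>K\<close> contributes only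
  \<open>t powr b * ln K / C2\<close>, which vanishes as \<open>t\<close> tends to 0.\<close>

lemma Liminf_ext_ln_ge:
  fixes m :: "real \<Rightarrow> real"
  assumes b: "0 < b" and C2: "0 < C2" and K: "0 < K" and t0: "0 < t0"
    and m: "\<And>t. 0 \<le> m t" "\<And>t. 0 < t \<Longrightarrow> t < t0 \<Longrightarrow> m t \<le> K * exp (- (C2 * R * t powr (- b)))"
  shows "ereal R \<le> Liminf (at_right 0) (\<lambda>t. - (ereal (t powr b) * ext_ln (m t)) / ereal C2)"
proof -
  let ?f = "\<lambda>t. - (ereal (t powr b) * ext_ln (m t)) / ereal C2"
  let ?g = "\<lambda>t. R - t powr b * ln K / C2"
  have "((\<lambda>t. t powr b) \<longlongrightarrow> 0) (at_right 0)"
    using b by real_asymp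
  then have "(?g \<longlongrightarrow> R - 0 * ln K / C2) (at_right 0)"
    by (intro tendsto_intros) (use C2 in auto)
  then have lim: "((\<lambda>t. ereal (?g t)) \<longlongrightarrow> ereal R) (at_right 0)"
    by simp
  have "eventually (\<lambda>t. ereal (?g t) \<le> ?f t) (at_right 0)"
    unfolding eventually_at_right_field
  proof (intro exI[of _ t0] conjI allI impI t0)
    fix t assume t: "0 < t" "t < t0"
    show "ereal (?g t) \<le> ?f t"
    proof (cases "m t = 0")
      case True
      \<comment> \<open>The logarithm is -\<infinity> and its factor positive, so the right-hand
        side is \<infinity>.\<close>
      then show ?thesis using t C2 by (simp add: ext_ln_def)
    next
      case False
      then have "0 < m t" using m(1)[of t] by simp
      then have "ln (m t) \<le> ln (K * exp (- (C2 * R * t powr (- b))))"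
        using m(2)[OF t] K by simp
      also have "\<dots> = ln K - C2 * R * t powr (- b)"
        using K by (simp add: ln_mult)
      finally have "t powr b * ln (m t) \<le> t powr b * (ln K - C2 * R * t powr (- b))"
        by (intro mult_left_mono) auto
      also have "\<dots> = t powr b * ln K - C2 * R"
        using t by (simp add: right_diff_distrib powr_minus field_simps)
      finally have "(C2 * R - t powr b * ln K) / C2 \<le> - (t powr b * ln (m t)) / C2"
        using C2 by (intro divide_right_mono) auto
      then have "?g t \<le> - (t powr b * ln (m t)) / C2"
        using C2 by (simp add: diff_divide_distrib)
      then show ?thesis
        using False C2 by (simp add: ext_ln_def)
    qed
  qed
  then have "Liminf (at_right 0) (\<lambda>t. ereal (?g t)) \<le> Liminf (at_right 0) ?f"
    by (rule Liminf_mono)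
  then show ?thesis
    using lim_imp_Liminf[OF _ lim] by simp
qed

text \<open>The empty set is polar, so the supremum has a member; over an empty family it would be
  -\<infinity>.\<close>

lemma polar_dist_nonneg: "0 \<le> polar_dist X P x B"
proof -
  have "{} \<in> polar_sets X P"
    unfolding polar_sets_def nearly_borel_def hitting_time_def
    by (auto intro!: bexI[of _ "{}"])
  then have "set_dist x B \<le> polar_dist X P x B"
    unfolding polar_dist_def by (intro SUP_upper2[of "{}"]) auto
  moreover have "0 \<le> set_dist x B"
    unfolding set_dist_def by (intro INF_greatest) auto
  ultimately show ?thesis by (rule order_trans[rotated])
qed

text \<open>The power is left continuous at a finite positive \<open>D\<close> and tends to
  \<infinity> at infinity, so bounds for real \<open>r\<close> below \<open>D\<close> pass to
  \<open>D\<close>. For \<open>D = 0\<close> there is no such \<open>r\<close>, and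
  \<open>0 \<le> L\<close> settles the case.\<close>

lemma ext_powr_le:
  assumes "0 < c" and "0 \<le> D" and "0 \<le> L"
    and le: "\<And>r. 0 < r \<Longrightarrow> ereal r < D \<Longrightarrow> ereal (r powr c) \<le> L"
  shows "ext_powr D c \<le> L"
proof (cases "0 < D")
  case False
  then have "D = 0" using assms(2) by simp
  then show ?thesis
    using assms(3) by (simp add: ext_powr_def zero_ereal_def)
next
  case True
  show ?thesis
  proof (cases D)
    case (real d)
    then have d: "0 < d" using True by simp
    have "((\<lambda>r. ereal (r powr c)) \<longlongrightarrow> ereal (d powr c)) (at_left d)"
      using d by (intro tendsto_intros) auto
    moreover have "eventually (\<lambda>r. ereal (r powr c) \<le> L) (at_left d)"
      unfolding eventually_at_left_field using d le real by (intro exI[of _ 0]) auto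
    ultimately have "ereal (d powr c) \<le> L"
      by (rule tendsto_upperbound) simp
    then show ?thesis using real by (simp add: ext_powr_def)
  next
    case PInf
    have "((\<lambda>r. ereal (r powr c)) \<longlongrightarrow> \<infinity>) at_top"
      unfolding tendsto_PInfty_eq_at_top using \<open>0 < c\<close> by real_asymp
    moreover have "eventually (\<lambda>r. ereal (r powr c) \<le> L) at_top"
      using eventually_gt_at_top[of 0] by eventually_elim (use le PInf in auto)
    ultimately have "\<infinity> \<le> L"
      by (rule tendsto_upperbound) simp
    then show ?thesis using PInf by (simp add: ext_powr_def)
  qed (use True in auto)
qed

theorem theorem6p1:
  fixes \<mu> :: "'a::{metric_space, second_countable_topology} measure"
    and \<Omega> :: "'w set"
    and X :: "real \<Rightarrow> 'w \<Rightarrow> 'a option"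
    and \<theta> :: "real \<Rightarrow> 'w \<Rightarrow> 'w"
    and P :: "'a \<Rightarrow> 'w measure"
    and Pt :: "real \<Rightarrow> 'a \<Rightarrow> 'a measure"
    and p :: "real \<Rightarrow> 'a \<Rightarrow> 'a \<Rightarrow> real"
    and C0 C1 C2 \<alpha> \<beta> T :: real
    and x :: 'a and B :: "'a set"
  assumes "lusin_space (euclidean :: 'a topology)"
    and "sets \<mu> = sets borel" and "sigma_finite_measure \<mu>" and "full_support \<mu>"
    and "borel_right_process \<Omega> X \<theta> P Pt"
    and AC: "\<And>t x. 0 < t \<Longrightarrow> absolutely_continuous \<mu> (Pt t x)"
    and "transition_density \<mu> Pt p"
    and "0 < C0" and "0 < \<alpha>"
    and "\<And>x r. 0 < r \<Longrightarrow> emeasure \<mu> (ball x r) \<le> ennreal (C0 * r powr \<alpha>)"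
    and "1 < \<beta>" and "0 < T" and "0 < C1" and "0 < C2"
    and "\<And>t y z. 0 < t \<Longrightarrow> t \<le> T \<Longrightarrow>
           p t y z \<le> C1 / t powr (\<alpha> / \<beta>) *
             exp (- C2 * (dist y z / t powr (1 / \<beta>)) powr (\<beta> / (\<beta> - 1)))"
    and "B \<in> nearly_borel X P"
  shows "Liminf (at_right 0)
           (\<lambda>t. - (ereal (t powr (1 / (\<beta> - 1))) *
                 ext_ln (measure (completion (P x)) {\<omega> \<in> \<Omega>. hitting_time X B \<omega> \<le> ennreal t}))
               / ereal C2)
         \<ge> ext_powr (polar_dist X P x B) (\<beta> / (\<beta> - 1))"
proof -
  interpret metric_right_process \<Omega> X \<theta> P Pt
    using assms(5) by (rule metric_right_process.intro)
  interpret Px: prob_space "completion (P x)"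
    by (intro prob_space.prob_space_completion prob_space_P)
  note \<beta> = \<open>1 < \<beta>\<close> and C2 = \<open>0 < C2\<close>
  let ?m = "\<lambda>t. measure (completion (P x)) {\<omega> \<in> \<Omega>. hitting_time X B \<omega> \<le> ennreal t}"
  have b: "0 < 1 / (\<beta> - 1)" using \<beta> by simp
  \<comment> \<open>Stated for all \<theta> at once, with \<open>K\<close> depending on \<theta>,
    because \<open>exit_probability_bound\<close> picks \<theta> only after \<open>r\<close> is
    known.\<close>
  have tail: "\<forall>\<theta>. 0 < \<theta> \<and> \<theta> < 1 \<longrightarrow> (\<exists>K>0. \<forall>s y r. 0 < s \<longrightarrow> s \<le> T \<longrightarrow> 0 \<le> r \<longrightarrow>
      emeasure (Pt s y) {z. r < dist y z} \<le>
        ennreal (K * exp (- (\<theta> * C2 * r powr (\<beta> / (\<beta> - 1)) * s powr (- (1 / (\<beta> - 1)))))))"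
  proof (intro allI impI, elim conjE)
    fix \<theta> :: real assume \<theta>: "0 < \<theta>" "\<theta> < 1"
    note bound = transition_tail_bound[OF assms(2) transition_function assms(7) less_imp_le[OF assms(8)]
        assms(10) \<beta> assms(13) C2 assms(15) \<theta>]
    show "\<exists>K>0. \<forall>s y r. 0 < s \<longrightarrow> s \<le> T \<longrightarrow> 0 \<le> r \<longrightarrow>
      emeasure (Pt s y) {z. r < dist y z} \<le>
        ennreal (K * exp (- (\<theta> * C2 * r powr (\<beta> / (\<beta> - 1)) * s powr (- (1 / (\<beta> - 1))))))"
      by (rule bound) blast+
  qed
  show ?thesis
  proof (rule ext_powr_le)
    show "0 < \<beta> / (\<beta> - 1)" using \<beta> by simp
    show "0 \<le> polar_dist X P x B" by (rule polar_dist_nonneg)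
    \<comment> \<open>Probabilities are at most 1, which is the case \<open>R = 0\<close>,
      \<open>K = 1\<close>.\<close>
    show "0 \<le> Liminf (at_right 0) (\<lambda>t. - (ereal (t powr (1 / (\<beta> - 1))) * ext_ln (?m t)) / ereal C2)"
      using Liminf_ext_ln_ge[OF b C2 zero_less_one zero_less_one, of ?m 0] by (simp add: zero_ereal_def)
    fix r assume r: "0 < r" "ereal r < polar_dist X P x B"
    obtain K t0 where K: "0 < K" "0 < t0" "\<And>t. 0 < t \<Longrightarrow> t < t0 \<Longrightarrow>
        ?m t \<le> K * exp (- (C2 * r powr (\<beta> / (\<beta> - 1)) * t powr (- (1 / (\<beta> - 1)))))"
    using hitting_probability_bound[OF \<beta> \<open>0 < T\<close> C2 r tail] by blast
    then show "ereal (r powr (\<beta> / (\<beta> - 1))) \<le>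
        Liminf (at_right 0) (\<lambda>t. - (ereal (t powr (1 / (\<beta> - 1))) * ext_ln (?m t)) / ereal C2)"
      using K(3) by (intro Liminf_ext_ln_ge[OF b C2 K(1,2)]) auto
  qed
qed

end
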